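(* Let $\mathcal{X},\mathcal{Y}$ be finite sets, $\mathcal{W}_{Y|X,Y'}$ a Markov channel kernel such that for every input distribution on $\mathcal{X}$ the induced Markov chain on $\mathcal{Y}$ has a unique recurrent class, which is irreducible and aperiodic, and let $\mathcal{P}_X$ be a distribution on $\mathcal{X}$ with associated equilibrium distribution $\pi$. Put $\mathcal{Q}_{Y'XY}=\pi_{Y'}\mathcal{P}_X\mathcal{W}_{Y|X,Y'}$. Let $Y_0$ be an arbitrary starting state and let $(X^n,Y^n)\sim\mathcal{P}_X^{\otimes n}\cdot\prod_{t=1}^n\mathcal{W}_{Y|X,Y'}(Y_t|X_t,Y_{t-1})$. Then $$\forall\varepsilon>0,\qquad\lim_{n\to\infty}\mathbb{P}\big((X^n,Y^n)\in\mathcal{T}_\varepsilon^{(n)}(\mathcal{Q}_{Y'XY})\big)=1.$$ In fact, the convergence is almost sure: $\lVert Q^n_{Y'XY}-\mathcal{Q}_{Y'XY}\rVert_1\to 0$ almost surely as $n\to\infty$, where $Q^n_{Y'XY}$ is the empirical distribution of the triplets $(Y_{t-1},X_t,Y_t)$, $t=1,\dots,n$.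
   Context: $\mathcal{W}_{Y|X,Y'}(y|x,y')$ is the probability of new state $y$ given input $x$ and previous state $y'$. For an input distribution $\mathcal{P}_X$, the induced Markov chain on $\mathcal{Y}$ has transition matrix $T(y|y')=\sum_x\mathcal{P}_X(x)\mathcal{W}_{Y|X,Y'}(y|x,y')$, and $\pi$ is its unique equilibrium distribution: $\pi(y)=\sum_{x,y'}\pi(y')\mathcal{P}_X(x)\mathcal{W}_{Y|X,Y'}(y|x,y')$. Thus $\mathcal{Q}_{Y'XY}(i,x,j)=\pi(i)\mathcal{P}_X(x)\mathcal{W}_{Y|X,Y'}(j|x,i)$. For sequences $(x^n,y^n)\in\mathcal{X}^n\times\mathcal{Y}^n$ with starting state $y_0$, define $$Q^n_{Y'XY}(i,x,j)=\frac1n\sum_{t=1}^n\mathbf{1}\{(y_{t-1},x_t,y_t)=(i,x,j)\},\quad x\in\mathcal{X},\ (i,j)\in\mathcal{Y}^2.$$ The set of input-driven Markov typical sequences is $\mathcal{T}_\varepsilon^{(n)}(\mathcal{Q}_{Y'XY})=\{(x^n,y^n):\lVert Q^n_{Y'XY}-\mathcal{Q}_{Y'XY}\rVert_1\leq\varepsilon\}$, where $\lVert\cdot\rVert_1$ is the $\ell_1$ norm (sum of absolute values). For the almost sure statement, $(X_t,Y_t)_{t\geq1}$ is the infinite process, with starting state $Y_0$, such that for each $n$ its first $n$ coordinates $(X^n,Y^n)$ have the law $\mathcal{P}_X^{\otimes n}\cdot\prod_{t=1}^n\mathcal{W}_{Y|X,Y'}(Y_t|X_t,Y_{t-1})$;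 that is, the $X_t$ are i.i.d. with distribution $\mathcal{P}_X$, and $Y_t$ is drawn according to $\mathcal{W}_{Y|X,Y'}(\cdot|X_t,Y_{t-1})$ for every $t\geq1$. *)

theory Defs
  imports "HOL-Probability.Probability"
begin

section \<open>Finite Markov chains\<close>

text \<open>A transition matrix is a function \<open>K\<close>, where \<open>K i j\<close> is the probability of moving
  from \<open>i\<close> to \<open>j\<close>.\<close>

fun n_step :: "('y::finite \<Rightarrow> 'y \<Rightarrow> real) \<Rightarrow> nat \<Rightarrow> 'y \<Rightarrow> 'y \<Rightarrow> real" where
  "n_step K 0 i j = (if i = j then 1 else 0)"
| "n_step K (Suc n) i j = (\<Sum>k\<in>UNIV. K i k * n_step K n k j)"

text \<open>\<open>first_passage K n i j\<close> is the probability that the chain started in \<open>i\<close> visits \<open>j\<close> for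
  the first time after time \<open>0\<close> exactly at time \<open>n\<close>.\<close>

fun first_passage :: "('y::finite \<Rightarrow> 'y \<Rightarrow> real) \<Rightarrow> nat \<Rightarrow> 'y \<Rightarrow> 'y \<Rightarrow> real" where
  "first_passage K 0 i j = 0"
| "first_passage K (Suc 0) i j = K i j"
| "first_passage K (Suc (Suc n)) i j =
     (\<Sum>k\<in>UNIV - {j}. K i k * first_passage K (Suc n) k j)"

text \<open>A state is recurrent if the chain started there returns with probability one.\<close>

definition recurrent :: "('y::finite \<Rightarrow> 'y \<Rightarrow> real) \<Rightarrow> 'y \<Rightarrow> bool" where
  "recurrent K i \<longleftrightarrow> (\<lambda>n. first_passage K n i i) sums 1"

definition accessible :: "('y::finite \<Rightarrow> 'y \<Rightarrow> real) \<Rightarrow> 'y \<Rightarrow> 'y \<Rightarrow> bool" where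
  "accessible K i j \<longleftrightarrow> (\<exists>n. n_step K n i j > 0)"

definition communicating_class :: "('y::finite \<Rightarrow> 'y \<Rightarrow> real) \<Rightarrow> 'y set \<Rightarrow> bool" where
  "communicating_class K C \<longleftrightarrow> (\<exists>i. C = {j. accessible K i j \<and> accessible K j i})"

definition recurrent_class :: "('y::finite \<Rightarrow> 'y \<Rightarrow> real) \<Rightarrow> 'y set \<Rightarrow> bool" where
  "recurrent_class K C \<longleftrightarrow> communicating_class K C \<and> (\<forall>i\<in>C. recurrent K i)"

definition irreducible_on :: "('y::finite \<Rightarrow> 'y \<Rightarrow> real) \<Rightarrow> 'y set \<Rightarrow> bool" where
  "irreducible_on K C \<longleftrightarrow> (\<forall>i\<in>C. \<forall>j\<in>C. accessible K i j)"

definition period :: "('y::finite \<Rightarrow> 'y \<Rightarrow> real) \<Rightarrow> 'y \<Rightarrow> nat" where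
  "period K i = Gcd {n. n > 0 \<and> n_step K n i i > 0}"

definition aperiodic_on :: "('y::finite \<Rightarrow> 'y \<Rightarrow> real) \<Rightarrow> 'y set \<Rightarrow> bool" where
  "aperiodic_on K C \<longleftrightarrow> (\<forall>i\<in>C. period K i = 1)"

text \<open>Irreducibility already follows from \<open>C\<close> being a communicating class; it is kept as an
  explicit clause.\<close>

definition unique_ergodic_class :: "('y::finite \<Rightarrow> 'y \<Rightarrow> real) \<Rightarrow> bool" where
  "unique_ergodic_class K \<longleftrightarrow>
     (\<exists>!C. recurrent_class K C) \<and>
     (\<forall>C. recurrent_class K C \<longrightarrow> irreducible_on K C \<and> aperiodic_on K C)"

section \<open>Markov channels\<close>

text \<open>A channel kernel is a function \<open>W\<close>, where \<open>W x y'\<close> is the distribution of the new state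
  given the input \<open>x\<close> and the previous state \<open>y'\<close>.  Note the argument order of
  \<open>induced_chain\<close>: previous state first, new state second.\<close>

definition induced_chain ::
  "'x::finite pmf \<Rightarrow> ('x \<Rightarrow> 'y \<Rightarrow> 'y pmf) \<Rightarrow> 'y::finite \<Rightarrow> 'y \<Rightarrow> real" where
  "induced_chain P W y' y = (\<Sum>x\<in>UNIV. pmf P x * pmf (W x y') y)"

definition equilibrium ::
  "'x::finite pmf \<Rightarrow> ('x \<Rightarrow> 'y \<Rightarrow> 'y pmf) \<Rightarrow> 'y::finite pmf \<Rightarrow> bool" where
  "equilibrium P W \<pi> \<longleftrightarrow>
     (\<forall>y. pmf \<pi> y = (\<Sum>x\<in>UNIV. \<Sum>y'\<in>UNIV. pmf \<pi> y' * pmf P x * pmf (W x y') y))"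

definition triple_dist ::
  "'y pmf \<Rightarrow> 'x pmf \<Rightarrow> ('x \<Rightarrow> 'y \<Rightarrow> 'y pmf) \<Rightarrow> 'y \<times> 'x \<times> 'y \<Rightarrow> real" where
  "triple_dist \<pi> P W = (\<lambda>(i, x, j). pmf \<pi> i * pmf P x * pmf (W x i) j)"

definition l1_dist :: "('a::finite \<Rightarrow> real) \<Rightarrow> ('a \<Rightarrow> real) \<Rightarrow> real" where
  "l1_dist f g = (\<Sum>z\<in>UNIV. \<bar>f z - g z\<bar>)"

text \<open>Finite sequences \<open>x\<^sub>1, \<dots>, x\<^sub>n\<close> and \<open>y\<^sub>1, \<dots>, y\<^sub>n\<close> are lists of length \<open>n\<close>, so that
  \<open>x\<^sub>t\<close> is \<open>xs ! (t - 1)\<close>; with a starting state \<open>y0\<close>, \<open>y\<^sub>t\<close> is \<open>(y0 # ys) ! t\<close> for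
  \<open>0 \<le> t \<le> n\<close>.\<close>

definition empirical :: "nat \<Rightarrow> 'y \<Rightarrow> 'x list \<Rightarrow> 'y list \<Rightarrow> 'y \<times> 'x \<times> 'y \<Rightarrow> real" where
  "empirical n y0 xs ys = (\<lambda>(i, x, j).
     1 / real n *
       (\<Sum>t=1..n. of_bool (((y0 # ys) ! (t - 1), xs ! (t - 1), (y0 # ys) ! t) = (i, x, j))))"

definition typical_set ::
  "nat \<Rightarrow> real \<Rightarrow> 'y \<Rightarrow> ('y::finite \<times> 'x::finite \<times> 'y \<Rightarrow> real) \<Rightarrow> ('x list \<times> 'y list) set" where
  "typical_set n \<epsilon> y0 Q =
     {(xs, ys). length xs = n \<and> length ys = n \<and> l1_dist (empirical n y0 xs ys) Q \<le> \<epsilon>}"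

text \<open>\<open>prefix_seq Z n \<omega>\<close> is the list \<open>[Z\<^sub>1 \<omega>, \<dots>, Z\<^sub>n \<omega>]\<close>.\<close>

definition prefix_seq :: "(nat \<Rightarrow> 'w \<Rightarrow> 'a) \<Rightarrow> nat \<Rightarrow> 'w \<Rightarrow> 'a list" where
  "prefix_seq Z n \<omega> = map (\<lambda>t. Z t \<omega>) [1..<Suc n]"

text \<open>The starting state \<open>Y 0\<close> may be deterministic or random with an arbitrary law: given
  \<open>Y 0 = y0\<close>, the first \<open>n\<close> coordinates have the product law below.  The variable \<open>X 0\<close> plays
  no role.\<close>

definition input_driven_process ::
  "'w measure \<Rightarrow> 'x::finite pmf \<Rightarrow> ('x \<Rightarrow> 'y \<Rightarrow> 'y pmf) \<Rightarrow>
   (nat \<Rightarrow> 'w \<Rightarrow> 'x) \<Rightarrow> (nat \<Rightarrow> 'w \<Rightarrow> 'y::finite) \<Rightarrow> bool" where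
  "input_driven_process M P W X Y \<longleftrightarrow>
     prob_space M \<and>
     (\<forall>t\<ge>1. X t \<in> M \<rightarrow>\<^sub>M count_space UNIV) \<and>
     (\<forall>t. Y t \<in> M \<rightarrow>\<^sub>M count_space UNIV) \<and>
     (\<forall>n y0 xs ys. length xs = n \<longrightarrow> length ys = n \<longrightarrow>
        measure M {\<omega> \<in> space M. Y 0 \<omega> = y0 \<and> prefix_seq X n \<omega> = xs \<and> prefix_seq Y n \<omega> = ys} =
        measure M {\<omega> \<in> space M. Y 0 \<omega> = y0} *
          ((\<Prod>t=1..n. pmf P (xs ! (t - 1))) *
           (\<Prod>t=1..n. pmf (W (xs ! (t - 1)) ((y0 # ys) ! (t - 1))) ((y0 # ys) ! t))))"

end

theory Submission
  imports Defs
begin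

text \<open>Every nonempty closed set of states of a finite chain contains a recurrent class.  The sets
  where a harmonic function attains its maximum and its minimum are closed, so with a unique
  recurrent class harmonic functions are constant and the Poisson equation \<open>f = g - K g\<close> is
  solvable for every \<open>f\<close> of \<open>\<pi>\<close>-mean zero.  Hence the deviation of the count of a triple from its
  expected value is, up to the bounded term \<open>g Y\<^sub>0 - g Y\<^sub>n\<close>, a sum of conditionally centred
  bounded increments.  Chernoff's method bounds the tails of this sum geometrically in \<open>n\<close>, and
  the Borel--Cantelli lemma gives almost sure convergence.\<close>

section \<open>Harmonic functions of a finite chain\<close>

locale stochastic_matrix =
  fixes K :: "'y::finite \<Rightarrow> 'y \<Rightarrow> real"
  assumes nonneg: "0 \<le> K i j" and row_sum: "(\<Sum>j\<in>UNIV. K i j) = 1"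
begin

section \<open>Accessibility and closed sets of states\<close>

lemma n_step_nonneg: "0 \<le> n_step K n i j"
  by (induction n arbitrary: i) (auto intro!: sum_nonneg mult_nonneg_nonneg nonneg)

lemma n_step_Suc_posE:
  assumes "0 < n_step K (Suc n) i j"
  obtains k where "0 < K i k" "0 < n_step K n k j"
proof -
  have "\<exists>k. 0 < K i k * n_step K n k j"
  proof (rule ccontr)
    assume "\<nexists>k. 0 < K i k * n_step K n k j"
    then have "(\<Sum>k\<in>UNIV. K i k * n_step K n k j) \<le> 0"
      by (intro sum_nonpos) (simp add: not_less)
    then show False using assms by simp
  qed
  then show thesis
    using that nonneg n_step_nonneg by (metis less_eq_real_def mult_zero_left mult_zero_right)
qed

lemma accessible_refl: "accessible K i i"
  unfolding accessible_def by (rule exI[of _ 0]) simp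

lemma accessible_step:
  assumes "0 < K i k" "accessible K k j"
  shows "accessible K i j"
proof -
  obtain n where n: "0 < n_step K n k j" using assms(2) by (auto simp: accessible_def)
  have "0 < K i k * n_step K n k j" using assms(1) n by simp
  also have "\<dots> \<le> (\<Sum>l\<in>UNIV. K i l * n_step K n l j)"
    by (rule member_le_sum) (auto intro!: mult_nonneg_nonneg nonneg n_step_nonneg)
  finally have "0 < n_step K (Suc n) i j" by simp
  then show ?thesis unfolding accessible_def by blast
qed

lemma accessible_trans:
  assumes "accessible K i k" "accessible K k j"
  shows "accessible K i j"
proof -
  obtain n where "0 < n_step K n i k" using assms(1) by (auto simp: accessible_def)
  then show ?thesis
  proof (induction n arbitrary: i)
    case 0
    then show ?case using assms(2) by (simp split: if_splits)
  next
    case (Suc n)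
    then show ?case by (metis n_step_Suc_posE accessible_step)
  qed
qed

definition closed_class :: "'y set \<Rightarrow> bool" where
  "closed_class A \<longleftrightarrow> (\<forall>i\<in>A. \<forall>j. 0 < K i j \<longrightarrow> j \<in> A)"

lemma closed_class_accessible:
  assumes "closed_class A" "i \<in> A" "accessible K i j"
  shows "j \<in> A"
proof -
  obtain n where "0 < n_step K n i j" using assms(3) by (auto simp: accessible_def)
  then show ?thesis using assms(2)
  proof (induction n arbitrary: i)
    case 0
    then show ?case by (simp split: if_splits)
  next
    case (Suc n)
    then show ?case using assms(1) by (metis n_step_Suc_posE closed_class_def)
  qed
qed

text \<open>An average of values at most \<open>U\<close> can equal \<open>U\<close> only if no
  value of positive weight falls short. A bound on \<open>A\<close> suffices, because
  \<open>A\<close> is closed and the weights \<open>K i l\<close> vanish outside it.\<close>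

lemma maximum_principle:
  assumes "closed_class A" "i \<in> A" "\<And>l. l \<in> A \<Longrightarrow> v l \<le> U"
    and "(\<Sum>l\<in>UNIV. K i l * v l) = U" "0 < K i k"
  shows "v k = U"
proof -
  have "0 = U * (\<Sum>l\<in>UNIV. K i l) - (\<Sum>l\<in>UNIV. K i l * v l)"
    using assms(4) by (simp add: row_sum)
  also have "\<dots> = (\<Sum>l\<in>UNIV. K i l * (U - v l))"
    by (simp add: sum_distrib_left sum_subtractf[symmetric] algebra_simps)
  finally have 0: "(\<Sum>l\<in>UNIV. K i l * (U - v l)) = 0" by simp
  have "0 \<le> K i l * (U - v l)" for l
  proof (cases "0 < K i l")
    case True
    then have "l \<in> A" using assms(1,2) by (auto simp: closed_class_def)
    then show ?thesis using assms(3)[of l] True by simp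
  next
    case False
    then show ?thesis using nonneg[of i l] by simp
  qed
  then have "\<forall>l\<in>UNIV. K i l * (U - v l) = 0"
    using 0 by (subst (asm) sum_nonneg_eq_0_iff) auto
  then show ?thesis using assms(5) by (metis UNIV_I eq_iff_diff_eq_0 mult_eq_0_iff less_irrefl)
qed

section \<open>First-passage probabilities and recurrence\<close>

lemma first_passage_nonneg: "0 \<le> first_passage K n i j"
proof (induction n arbitrary: i)
  case (Suc n)
  then show ?case
    by (cases n) (auto intro!: sum_nonneg mult_nonneg_nonneg nonneg)
qed simp

lemma row_sum_remove: "(\<Sum>l\<in>UNIV - {j}. K i l) = 1 - K i j"
  using row_sum[of i] by (simp add: sum_diff1)

text \<open>First-step decomposition: the chain enters \<open>j\<close> at once or moves to another
  state with one unit of time less. The range includes time one because the recursion of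
  \<open>first_passage\<close> applies only from time two on.\<close>

lemma first_passage_partial_sum_Suc:
  "(\<Sum>m<Suc (Suc n). first_passage K m i j) =
     K i j + (\<Sum>l\<in>UNIV - {j}. K i l * (\<Sum>m<Suc n. first_passage K m l j))"
proof (induction n)
  case 0
  then show ?case by simp
next
  case (Suc n)
  have "(\<Sum>m<Suc (Suc (Suc n)). first_passage K m i j) =
      (\<Sum>m<Suc (Suc n). first_passage K m i j) + first_passage K (Suc (Suc n)) i j"
    by simp
  also have "\<dots> = K i j + (\<Sum>l\<in>UNIV - {j}. K i l * (\<Sum>m<Suc n. first_passage K m l j))
      + (\<Sum>l\<in>UNIV - {j}. K i l * first_passage K (Suc n) l j)"
    using Suc by simp
  also have "\<dots> = K i j + (\<Sum>l\<in>UNIV - {j}. K i l * (\<Sum>m<Suc (Suc n). first_passage K m l j))"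
    by (simp add: sum.distrib[symmetric] algebra_simps)
  finally show ?case .
qed

lemma first_passage_partial_sum_le: "(\<Sum>m<n. first_passage K m i j) \<le> 1"
proof -
  \<comment> \<open>The decomposition needs a successor as bound, so the induction is over
    \<open>Suc n\<close>; the nonnegative last term is dropped afterwards.\<close>
  have "(\<Sum>m<Suc n. first_passage K m i j) \<le> 1"
  proof (induction n arbitrary: i)
    case 0
    then show ?case by simp
  next
    case (Suc n)
    have "(\<Sum>l\<in>UNIV - {j}. K i l * (\<Sum>m<Suc n. first_passage K m l j)) \<le>
        (\<Sum>l\<in>UNIV - {j}. K i l * 1)"
      by (intro sum_mono mult_left_mono Suc nonneg)
    then show ?case
      unfolding first_passage_partial_sum_Suc by (simp add: row_sum_remove)
  qed
  then show ?thesis using first_passage_nonneg[of n i j] by simp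
qed

lemma summable_first_passage: "summable (\<lambda>m. first_passage K m i j)"
  using first_passage_nonneg first_passage_partial_sum_le by (intro summableI_nonneg_bounded) auto

text \<open>The first-step decomposition in the limit: an averaging equation for the probability of
  ever hitting \<open>j\<close>.\<close>

lemma first_passage_suminf:
  "(\<Sum>m. first_passage K m i j) =
     K i j + (\<Sum>l\<in>UNIV - {j}. K i l * (\<Sum>m. first_passage K m l j))"
proof (rule LIMSEQ_unique)
  have *: "(\<lambda>n. \<Sum>m<n. first_passage K m i j) \<longlonglongrightarrow> (\<Sum>m. first_passage K m i j)" for i
    by (rule summable_LIMSEQ[OF summable_first_passage])
  show "(\<lambda>n. \<Sum>m<Suc (Suc n). first_passage K m i j) \<longlonglongrightarrow> (\<Sum>m. first_passage K m i j)"
    by (rule LIMSEQ_Suc[OF LIMSEQ_Suc[OF *]])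
  have "(\<lambda>n. \<Sum>m<Suc n. first_passage K m i j) \<longlonglongrightarrow> (\<Sum>m. first_passage K m i j)" for i
    by (rule LIMSEQ_Suc[OF *])
  then show "(\<lambda>n. \<Sum>m<Suc (Suc n). first_passage K m i j) \<longlonglongrightarrow>
      K i j + (\<Sum>l\<in>UNIV - {j}. K i l * (\<Sum>m. first_passage K m l j))"
    unfolding first_passage_partial_sum_Suc by (intro tendsto_intros)
qed

text \<open>The probability of never hitting \<open>j\<close> is harmonic off \<open>j\<close>.  If its maximum over the class
  were positive, the maximum set would be closed without any transition into \<open>j\<close>.\<close>

lemma closed_irreducible_recurrent:
  assumes C: "closed_class C" and irr: "irreducible_on K C" and j: "j \<in> C"
  shows "recurrent K j"
proof -
  \<comment> \<open>\<open>u i\<close> is the probability that the chain from \<open>i\<close> never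
    visits \<open>j\<close> after time 0. Putting \<open>v j = 0\<close> discards first moves into
    \<open>j\<close>, so averaging \<open>v\<close> over one step returns \<open>u\<close>.\<close>
  define u where "u i = 1 - (\<Sum>m. first_passage K m i j)" for i
  define v where "v i = (if i = j then 0 else u i)" for i
  have u_nonneg: "0 \<le> u i" for i
    unfolding u_def using first_passage_partial_sum_le summable_first_passage
    by (simp add: suminf_le_const)
  have u_eq: "(\<Sum>l\<in>UNIV. K i l * v l) = u i" for i
  proof -
    have "(\<Sum>l\<in>UNIV. K i l * v l) = (\<Sum>l\<in>UNIV - {j}. K i l * u l)"
      by (rule sum.mono_neutral_cong_right) (auto simp: v_def)
    also have "\<dots> = (\<Sum>l\<in>UNIV - {j}. K i l) - (\<Sum>l\<in>UNIV - {j}. K i l * (\<Sum>m. first_passage K m l j))"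
      by (simp add: u_def sum_subtractf algebra_simps)
    also have "\<dots> = u i"
      unfolding row_sum_remove using first_passage_suminf[of i j] by (simp add: u_def)
    finally show ?thesis .
  qed
  define U where "U = Max (u ` C)"
  have U_ge: "u l \<le> U" if "l \<in> C" for l using that by (simp add: U_def)
  have "U \<in> u ` C" unfolding U_def using j by (intro Max_in) auto
  then obtain k where k: "k \<in> C" "u k = U" by auto
  have "U \<le> 0"
  proof (rule ccontr)
    assume "\<not> U \<le> 0"
    define D where "D = {i\<in>C. u i = U}"
    \<comment> \<open>The maximum principle forces \<open>v l = U\<close>, and
      \<open>v j = 0 < U\<close> rules out \<open>l = j\<close>.\<close>
    have step: "l \<in> D \<and> l \<noteq> j" if "i \<in> D" "0 < K i l" for i l
    proof -
      have "v l = U"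
      proof (rule maximum_principle[OF C])
        show "i \<in> C" using that by (simp add: D_def)
        show "v l \<le> U" if "l \<in> C" for l
          using U_ge[OF that] \<open>\<not> U \<le> 0\<close> by (simp add: v_def)
        show "(\<Sum>l\<in>UNIV. K i l * v l) = U" using that u_eq by (simp add: D_def)
      qed (fact that)
      moreover have "l \<in> C" using C that by (auto simp: closed_class_def D_def)
      ultimately show ?thesis using \<open>\<not> U \<le> 0\<close> by (auto simp: v_def D_def split: if_splits)
    qed
    have "closed_class (D - {j})" using step by (auto simp: closed_class_def)
    \<comment> \<open>The maximiser \<open>k\<close> may be \<open>j\<close> itself, so one
      transition is made to land in \<open>D - {j}\<close>.\<close>
    have "\<exists>l. 0 < K k l"
    proof (rule ccontr)
      assume "\<nexists>l. 0 < K k l"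
      then have "(\<Sum>l\<in>UNIV. K k l) \<le> 0" by (intro sum_nonpos) (simp add: not_less)
      then show False by (simp add: row_sum)
    qed
    then obtain l where "0 < K k l" ..
    then have l: "l \<in> D - {j}" using step[of k l] k by (simp add: D_def)
    then have "accessible K l j" using irr j by (auto simp: irreducible_on_def D_def)
    then show False using closed_class_accessible[OF \<open>closed_class (D - {j})\<close> l] by auto
  qed
  then have "u j = 0" using U_ge[OF j] u_nonneg[of j] by simp
  then show ?thesis
    unfolding recurrent_def u_def using summable_sums[OF summable_first_passage[of j j]] by simp
qed

text \<open>Take a state of \<open>A\<close> that reaches as few states as possible. By minimality
  every state it reaches has the same reachable set, so this set is closed and its states
  communicate.\<close>

lemma closed_class_contains_recurrent_class:
  assumes "closed_class A" "A \<noteq> {}"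
  obtains C where "recurrent_class K C" "C \<noteq> {}" "C \<subseteq> A"
proof -
  define R where "R i = {j. accessible K i j}" for i
  obtain i where i: "i \<in> A" and min: "\<And>k. k \<in> A \<Longrightarrow> card (R i) \<le> card (R k)"
    using ex_has_least_nat[of "\<lambda>i. i \<in> A" _ "\<lambda>i. card (R i)"] assms(2) by blast
  have R_sub: "R i \<subseteq> A" using closed_class_accessible[OF assms(1) i] by (auto simp: R_def)
  have R_eq: "R k = R i" if "k \<in> R i" for k
  proof (rule card_subset_eq)
    show "R k \<subseteq> R i" using that accessible_trans by (auto simp: R_def)
    then show "card (R k) = card (R i)"
      using min[of k] that R_sub by (meson card_mono finite le_antisym subsetD)
  qed simp
  have acc: "accessible K k l" if "k \<in> R i" "l \<in> R i" for k l
    using R_eq[OF that(1)] that(2) by (auto simp: R_def)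
  have iR: "i \<in> R i" by (simp add: R_def accessible_refl)
  have "closed_class (R i)"
    unfolding closed_class_def R_def
    using accessible_trans[OF _ accessible_step[OF _ accessible_refl]] by blast
  moreover have "irreducible_on K (R i)" using acc by (auto simp: irreducible_on_def)
  ultimately have "\<forall>j\<in>R i. recurrent K j" using closed_irreducible_recurrent by blast
  moreover have "communicating_class K (R i)"
    unfolding communicating_class_def using acc iR by (intro exI[of _ i]) (auto simp: R_def)
  ultimately have "recurrent_class K (R i)" unfolding recurrent_class_def by blast
  then show thesis using iR R_sub by (intro that[of "R i"]) blast+
qed

section \<open>Harmonic functions and the Poisson equation\<close>

lemma closed_class_argmax:
  assumes h: "\<And>i. (\<Sum>l\<in>UNIV. K i l * h l) = h i"
  shows "closed_class {i. h i = Max (range h)}"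
proof -
  have UNIV: "closed_class UNIV" by (simp add: closed_class_def)
  have "h j = Max (range h)" if "h i = Max (range h)" "0 < K i j" for i j
  proof (rule maximum_principle[OF UNIV UNIV_I])
    show "(\<Sum>l\<in>UNIV. K i l * h l) = Max (range h)" using h[of i] that(1) by (rule trans)
    show "h l \<le> Max (range h)" for l by (rule Max_ge) auto
  qed (fact that)
  then show ?thesis unfolding closed_class_def by blast
qed

text \<open>The maximum sets of \<open>h\<close> and of \<open>- h\<close> each contain a recurrent
  class. By uniqueness the two classes coincide, so some state is both a maximum and a minimum of
  \<open>h\<close>.\<close>

lemma harmonic_constant:
  assumes uniq: "\<exists>!C. recurrent_class K C"
    and h: "\<And>i. (\<Sum>l\<in>UNIV. K i l * h l) = h i"
  shows "h i = h j"
proof -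
  have h': "(\<Sum>l\<in>UNIV. K i l * - h l) = - h i" for i
    using h[of i] by (simp add: sum_negf)
  define A where "A = {i. h i = Max (range h)}"
  define B where "B = {i. - h i = Max (range (\<lambda>i. - h i))}"
  have "Max (range h) \<in> range h" by (intro Max_in) auto
  then have "A \<noteq> {}" unfolding A_def by (metis (mono_tags) empty_Collect_eq rangeE)
  then obtain C where C: "recurrent_class K C" "C \<noteq> {}" "C \<subseteq> A"
    using closed_class_contains_recurrent_class[OF closed_class_argmax[OF h]] unfolding A_def by blast
  have "Max (range (\<lambda>i. - h i)) \<in> range (\<lambda>i. - h i)" by (intro Max_in) auto
  then have "B \<noteq> {}" unfolding B_def by (metis (mono_tags, lifting) empty_Collect_eq rangeE)
  then obtain D where D: "recurrent_class K D" "D \<noteq> {}" "D \<subseteq> B"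
    using closed_class_contains_recurrent_class[OF closed_class_argmax[of "\<lambda>i. - h i", OF h']]
    unfolding B_def by blast
  have "C = D" using uniq C(1) D(1) by blast
  then obtain k where k: "k \<in> A" "k \<in> B" using C D by auto
  have "h k \<ge> h l" "- h k \<ge> - h l" for l
    using k by (simp_all add: A_def B_def)
  then have "h l = h k" for l by (simp add: order_antisym)
  then show ?thesis by metis
qed

text \<open>The operator \<open>g \<mapsto> g - K g + \<mu> g\<close> is injective, hence onto; integrating its equation
  against \<open>\<mu>\<close> shows that the last term vanishes when \<open>f\<close> has mean zero.\<close>

lemma poisson_equation:
  fixes \<mu> f :: "'y \<Rightarrow> real"
  assumes uniq: "\<exists>!C. recurrent_class K C"
    and mass: "(\<Sum>i\<in>UNIV. \<mu> i) = 1"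
    and stationary: "\<And>j. (\<Sum>i\<in>UNIV. \<mu> i * K i j) = \<mu> j"
    and mean: "(\<Sum>i\<in>UNIV. \<mu> i * f i) = 0"
  obtains g where "\<And>i. f i = g i - (\<Sum>j\<in>UNIV. K i j * g j)"
proof -
  define m where "m g = (\<Sum>i\<in>UNIV. \<mu> i * g i)" for g :: "'y \<Rightarrow> real"
  define T where "T g i = (\<Sum>j\<in>UNIV. K i j * g j)" for g :: "'y \<Rightarrow> real" and i
  have mT: "m (T g) = m g" for g
  proof -
    have "m (T g) = (\<Sum>j\<in>UNIV. \<Sum>i\<in>UNIV. \<mu> i * K i j * g j)"
      unfolding m_def T_def sum_distrib_left by (subst sum.swap) (simp add: mult.assoc)
    also have "\<dots> = m g" by (simp add: m_def stationary sum_distrib_right[symmetric])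
    finally show ?thesis .
  qed
  \<comment> \<open>The map without the mean annihilates constants; adding the mean repairs this. On
    the finite-dimensional space \<open>real^'y\<close> an injective linear map is onto.\<close>
  define A :: "real^'y \<Rightarrow> real^'y" where "A x = (\<chi> i. x $ i - T (($) x) i + m (($) x))" for x
  \<comment> \<open>By stationarity \<open>g\<close> and \<open>K g\<close> have equal means and
    cancel; the added constant is its own mean because \<open>\<mu>\<close> has total mass
    one.\<close>
  have mA: "m (($) (A x)) = m (($) x)" for x
  proof -
    define c where "c = m (($) x)"
    have "m (($) (A x)) = m (($) x) - m (T (($) x)) + c * (\<Sum>i\<in>UNIV. \<mu> i)"
    proof -
      have "m (($) (A x)) = (\<Sum>i\<in>UNIV. \<mu> i * (x $ i - T (($) x) i + c))"
        by (simp add: A_def m_def c_def)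
      then show ?thesis
        by (simp add: m_def sum.distrib sum_subtractf sum_distrib_left algebra_simps)
    qed
    then show ?thesis by (simp add: mT mass) (simp add: c_def)
  qed
  have lin: "linear A"
    by (rule linearI)
       (simp_all add: A_def T_def m_def vec_eq_iff sum.distrib sum_distrib_left algebra_simps)
  have "inj A"
    unfolding linear_injective_0[OF lin]
  proof (intro allI impI)
    \<comment> \<open>A vector in the kernel has mean zero, hence is harmonic, hence constant, and a
      constant of mean zero is zero.\<close>
    fix x assume x: "A x = 0"
    then have m0: "m (($) x) = 0" using mA[of x] by (simp add: m_def)
    have "T (($) x) i = x $ i" for i
      using x m0 by (auto simp: A_def vec_eq_iff)
    then have const: "x $ i = x $ j" for i j
      by (intro harmonic_constant[OF uniq]) (simp add: T_def)
    have "x $ i = 0" for i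
    proof -
      have "m (($) x) = (\<Sum>j\<in>UNIV. \<mu> j * x $ i)"
        unfolding m_def by (intro sum.cong refl arg_cong2[where f = "(*)"] const)
      then show ?thesis using m0 by (simp add: sum_distrib_right[symmetric] mass)
    qed
    then show "x = 0" by (simp add: vec_eq_iff)
  qed
  then have "surj A" using linear_injective_imp_surjective[OF lin] by blast
  then obtain x where x: "A x = (\<chi> i. f i)" unfolding surj_def by metis
  have "m (($) x) = 0" using mA[of x] mean
    by (simp add: x m_def)
  then have "f i = x $ i - (\<Sum>j\<in>UNIV. K i j * x $ j)" for i
    using x by (auto simp: A_def T_def vec_eq_iff)
  then show thesis using that by blast
qed

end

section \<open>Path sums of a Markov channel\<close>

text \<open>Each step makes the state just entered the new starting state, so that inductions can
  condition on the first transition.\<close>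

fun path_prob :: "'x pmf \<Rightarrow> ('x \<Rightarrow> 'y \<Rightarrow> 'y pmf) \<Rightarrow> 'y \<Rightarrow> ('x \<times> 'y) list \<Rightarrow> real" where
  "path_prob P W i [] = 1"
| "path_prob P W i ((x, j) # zs) = pmf P x * pmf (W x i) j * path_prob P W j zs"

fun path_sum :: "('y \<times> 'x \<times> 'y \<Rightarrow> real) \<Rightarrow> 'y \<Rightarrow> ('x \<times> 'y) list \<Rightarrow> real" where
  "path_sum G i [] = 0"
| "path_sum G i ((x, j) # zs) = G (i, x, j) + path_sum G j zs"

text \<open>The conditional expectation of \<open>G\<close> at a single transition, given the
  previous state \<open>i\<close>.\<close>

definition channel_mean ::
  "'x::finite pmf \<Rightarrow> ('x \<Rightarrow> 'y \<Rightarrow> 'y pmf) \<Rightarrow> ('y::finite \<times> 'x \<times> 'y \<Rightarrow> real) \<Rightarrow> 'y \<Rightarrow> real" where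
  "channel_mean P W G i = (\<Sum>x\<in>UNIV. \<Sum>j\<in>UNIV. pmf P x * pmf (W x i) j * G (i, x, j))"

lemma path_prob_nonneg: "0 \<le> path_prob P W i zs"
  by (induction P W i zs rule: path_prob.induct) auto

text \<open>Connects the recursion with the product law in \<open>input_driven_process\<close>.
  Shifting the products to start at index 0 splits off the first transition.\<close>

lemma path_prob_eq_prod:
  "path_prob P W i zs =
     (\<Prod>t=1..length zs. pmf P (map fst zs ! (t - 1))) *
     (\<Prod>t=1..length zs. pmf (W (map fst zs ! (t - 1)) ((i # map snd zs) ! (t - 1))) ((i # map snd zs) ! t))"
proof (induction P W i zs rule: path_prob.induct)
  case (2 P W i x j zs)
  then show ?case
    unfolding path_prob.simps list.map length_Cons One_nat_def prod.atLeast1_atMost_eq prod.lessThan_Suc_shift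
    by simp
qed simp

lemma path_sum_eq_sum:
  "path_sum G i zs =
     (\<Sum>t=1..length zs. G ((i # map snd zs) ! (t - 1), map fst zs ! (t - 1), (i # map snd zs) ! t))"
proof (induction G i zs rule: path_sum.induct)
  case (2 G i x j zs)
  then show ?case
    unfolding path_sum.simps list.map length_Cons One_nat_def sum.atLeast1_atMost_eq sum.lessThan_Suc_shift
    by simp
qed simp

lemma path_sum_cmult: "path_sum (\<lambda>z. c * G z) i zs = c * path_sum G i zs"
  by (induction G i zs rule: path_sum.induct) (auto simp: algebra_simps)

section \<open>Exponential moments and deviations of path sums\<close>

lemma finite_lists_length: "finite {zs :: 'a::finite list. length zs = n}"
  using finite_lists_length_eq[of "UNIV :: 'a set" n] by simp

lemma sum_lists_length_Suc:
  fixes f :: "('a::finite \<times> 'b::finite) list \<Rightarrow> real"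
  shows "(\<Sum>zs | length zs = Suc n. f zs) =
    (\<Sum>x\<in>UNIV. \<Sum>j\<in>UNIV. \<Sum>zs | length zs = n. f ((x, j) # zs))"
proof -
  have "{zs :: ('a \<times> 'b) list. length zs = Suc n} =
      (\<lambda>(x, j, zs). (x, j) # zs) ` (UNIV \<times> UNIV \<times> {zs. length zs = n})"
    by (force simp: length_Suc_conv image_iff)
  moreover have "inj_on (\<lambda>(x, j, zs). (x, j) # zs) (UNIV \<times> UNIV \<times> {zs :: ('a \<times> 'b) list. length zs = n})"
    by (auto simp: inj_on_def)
  ultimately show ?thesis
    by (simp add: sum.reindex sum.cartesian_product case_prod_unfold)
qed

text \<open>Condition on the first transition: the remaining path contributes at most
  \<open>c ^ n\<close> whatever state it starts from, and the first transition contributes one more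
  factor \<open>c\<close>.\<close>

lemma path_exp_moment_le:
  assumes "\<And>i. channel_mean P W (\<lambda>z. exp (G z)) i \<le> c"
  shows "(\<Sum>zs | length zs = n. path_prob P W i zs * exp (path_sum G i zs)) \<le> c ^ n"
proof (induction n arbitrary: i)
  case 0
  have "{zs :: ('a \<times> 'b) list. length zs = 0} = {[]}" by auto
  then show ?case by simp
next
  case (Suc n)
  have "0 \<le> channel_mean P W (\<lambda>z. exp (G z)) i"
    unfolding channel_mean_def by (intro sum_nonneg) simp
  have c: "0 \<le> c" using \<open>0 \<le> channel_mean _ _ _ _\<close> assms[of i] by linarith
  have "(\<Sum>zs | length zs = Suc n. path_prob P W i zs * exp (path_sum G i zs)) =
      (\<Sum>x\<in>UNIV. \<Sum>j\<in>UNIV. pmf P x * pmf (W x i) j * exp (G (i, x, j)) *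
         (\<Sum>zs | length zs = n. path_prob P W j zs * exp (path_sum G j zs)))"
    by (simp add: sum_lists_length_Suc sum_distrib_left exp_add algebra_simps)
  also have "\<dots> \<le> (\<Sum>x\<in>UNIV. \<Sum>j\<in>UNIV. pmf P x * pmf (W x i) j * exp (G (i, x, j)) * c ^ n)"
    by (intro sum_mono mult_left_mono Suc) simp
  also have "\<dots> = channel_mean P W (\<lambda>z. exp (G z)) i * c ^ n"
    by (simp add: channel_mean_def sum_distrib_right)
  also have "\<dots> \<le> c * c ^ n" using assms[of i] c by (intro mult_right_mono) auto
  finally show ?case by simp
qed

lemma exp_le_quadratic:
  fixes x :: real
  assumes "\<bar>x\<bar> \<le> 1"
  shows "exp x \<le> 1 + x + x\<^sup>2"
proof (cases "0 \<le> x")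
  case True
  then show ?thesis using assms exp_bound[of x] by simp
next
  case False
  \<comment> \<open>For negative \<open>x\<close> the claim follows from
    \<open>(1 + x + x\<^sup>2) * (1 - x) = 1 - x ^ 3\<close>, which is at least 1.\<close>
  have "exp x \<le> 1 / (1 - x)"
    using exp_ge_add_one_self[of "- x"] False by (simp add: exp_minus field_simps)
  also have "\<dots> \<le> 1 + x + x\<^sup>2"
  proof -
    have "(1 + x + x\<^sup>2) * (1 - x) = 1 + x\<^sup>2 * (- x)"
      by (simp add: power2_eq_square algebra_simps)
    moreover have "0 \<le> x\<^sup>2 * (- x)" using False by (intro mult_nonneg_nonneg) auto
    ultimately show ?thesis using False by (simp add: divide_le_eq)
  qed
  finally show ?thesis .
qed

lemma channel_mean_add: "channel_mean P W (\<lambda>z. F z + G z) i = channel_mean P W F i + channel_mean P W G i"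
  by (simp add: channel_mean_def sum.distrib algebra_simps)

lemma channel_mean_cmult: "channel_mean P W (\<lambda>z. c * G z) i = c * channel_mean P W G i"
  by (simp add: channel_mean_def sum_distrib_left algebra_simps)

lemma channel_mean_mono: "(\<And>z. F z \<le> G z) \<Longrightarrow> channel_mean P W F i \<le> channel_mean P W G i"
  unfolding channel_mean_def by (intro sum_mono mult_left_mono) auto

lemma sum_pmf_UNIV: "(\<Sum>x\<in>UNIV. pmf p x) = 1" for p :: "'a::finite pmf"
  by (rule sum_pmf_eq_1) auto

lemma channel_mean_const: "channel_mean P W (\<lambda>_. c) i = c"
  by (simp add: channel_mean_def sum_distrib_right[symmetric] sum_distrib_left[symmetric] sum_pmf_UNIV)

lemma path_deviation_le:
  fixes W :: "'x::finite \<Rightarrow> 'y::finite \<Rightarrow> 'y pmf"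
  assumes centered: "\<And>i. channel_mean P W G i = 0" and "0 < \<epsilon>"
  obtains r where "0 < r" "r < 1"
    "\<And>n i. (\<Sum>zs | length zs = n \<and> real n * \<epsilon> \<le> path_sum G i zs. path_prob P W i zs) \<le> r ^ n"
proof -
  \<comment> \<open>Inserting \<open>\<epsilon>\<close> keeps \<open>B\<close> positive even for
    \<open>G = 0\<close> and gives \<open>l * B \<le> 1\<close>, as the quadratic bound on
    \<open>exp\<close> requires.\<close>
  define B where "B = Max (insert \<epsilon> (range (\<lambda>z. \<bar>G z\<bar>)))"
  have B: "\<epsilon> \<le> B" "\<bar>G z\<bar> \<le> B" for z unfolding B_def by (intro Max_ge; simp)+
  have "0 < B" using B(1) \<open>0 < \<epsilon>\<close> by linarith
  \<comment> \<open>This \<open>l\<close> minimises the exponent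
    \<open>(l * B)\<^sup>2 - l * \<epsilon>\<close> of \<open>r\<close>; the minimum is
    \<open>- (l * \<epsilon> / 2)\<close>.\<close>
  define l where "l = \<epsilon> / (2 * B\<^sup>2)"
  define c where "c = exp ((l * B)\<^sup>2)"
  define r where "r = c * exp (- l * \<epsilon>)"
  have "0 < l" using \<open>0 < B\<close> \<open>0 < \<epsilon>\<close> by (simp add: l_def)
  have "l * B = \<epsilon> / (2 * B)" using \<open>0 < B\<close> by (simp add: l_def power2_eq_square)
  then have "l * B \<le> 1" using B(1) \<open>0 < B\<close> by (simp add: divide_le_eq)
  have lG: "\<bar>l * G z\<bar> \<le> l * B" for z using B(2) \<open>0 < l\<close> by (simp add: abs_mult)
  have "channel_mean P W (\<lambda>z. exp (l * G z)) i \<le> c" for i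
  proof -
    \<comment> \<open>The linear term on the right has channel mean zero by centring, which leaves
      only the quadratic one.\<close>
    have "exp (l * G z) \<le> (1 + (l * B)\<^sup>2) + l * G z" for z
    proof -
      have "exp (l * G z) \<le> 1 + l * G z + (l * G z)\<^sup>2"
        using lG[of z] \<open>l * B \<le> 1\<close> by (intro exp_le_quadratic) linarith
      moreover have "(l * G z)\<^sup>2 \<le> (l * B)\<^sup>2"
        using lG[of z] \<open>0 < l\<close> \<open>0 < B\<close> by (intro power2_le_iff_abs_le[THEN iffD2]) simp_all
      ultimately show ?thesis by simp
    qed
    then have "channel_mean P W (\<lambda>z. exp (l * G z)) i \<le> channel_mean P W (\<lambda>z. (1 + (l * B)\<^sup>2) + l * G z) i"
      by (rule channel_mean_mono)
    also have "\<dots> = 1 + (l * B)\<^sup>2"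
      by (simp add: channel_mean_add channel_mean_cmult channel_mean_const centered)
    also have "\<dots> \<le> c" unfolding c_def by (rule exp_ge_add_one_self)
    finally show ?thesis .
  qed
  then have moment: "(\<Sum>zs | length zs = n. path_prob P W i zs * exp (l * path_sum G i zs)) \<le> c ^ n" for n i
    using path_exp_moment_le[of P W "\<lambda>z. l * G z" c i n] by (simp add: path_sum_cmult)
  have "(\<Sum>zs | length zs = n \<and> real n * \<epsilon> \<le> path_sum G i zs. path_prob P W i zs) \<le> r ^ n" for n i
  proof -
    let ?A = "{zs :: ('x \<times> 'y) list. length zs = n \<and> real n * \<epsilon> \<le> path_sum G i zs}"
    let ?f = "\<lambda>zs. path_prob P W i zs * exp (l * path_sum G i zs)"
    have "(\<Sum>zs\<in>?A. path_prob P W i zs) \<le> (\<Sum>zs\<in>?A. exp (- l * \<epsilon>) ^ n * ?f zs)"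
    proof (rule sum_mono)
      \<comment> \<open>On the deviation event the weight
        \<open>exp (l * (path_sum G i zs - real n * \<epsilon>))\<close> is at least 1, so the
        exponential moment dominates the probability.\<close>
      fix zs assume "zs \<in> ?A"
      then have "0 \<le> l * (path_sum G i zs - real n * \<epsilon>)" using \<open>0 < l\<close> by simp
      then have "1 \<le> exp (l * (path_sum G i zs - real n * \<epsilon>))" by simp
      also have "\<dots> = exp (- l * \<epsilon>) ^ n * exp (l * path_sum G i zs)"
        by (simp add: exp_of_nat_mult[symmetric] exp_add[symmetric] algebra_simps)
      finally have "path_prob P W i zs * 1 \<le> path_prob P W i zs * (exp (- l * \<epsilon>) ^ n * exp (l * path_sum G i zs))"
        by (rule mult_left_mono) (rule path_prob_nonneg)
      then show "path_prob P W i zs \<le> exp (- l * \<epsilon>) ^ n * ?f zs" by (simp add: mult.left_commute)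
    qed
    also have "\<dots> \<le> (\<Sum>zs | length zs = n. exp (- l * \<epsilon>) ^ n * ?f zs)"
      by (rule sum_mono2) (auto simp: finite_lists_length path_prob_nonneg)
    also have "\<dots> \<le> exp (- l * \<epsilon>) ^ n * c ^ n"
      unfolding sum_distrib_left[symmetric] by (intro mult_left_mono moment) simp
    also have "\<dots> = r ^ n" by (simp add: r_def power_mult_distrib)
    finally show ?thesis .
  qed
  moreover have "r < 1"
  proof -
    have "(l * B)\<^sup>2 = l * \<epsilon> / 2" using \<open>0 < B\<close> by (simp add: l_def power2_eq_square)
    then have "r = exp (- (l * \<epsilon> / 2))" by (simp add: r_def c_def exp_add[symmetric])
    then show ?thesis using \<open>0 < l\<close> \<open>0 < \<epsilon>\<close> by simp
  qed
  moreover have "0 < r" by (simp add: r_def c_def)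
  ultimately show thesis using that by blast
qed

section \<open>Almost sure convergence\<close>

locale channel_process =
  fixes M :: "'w measure" and P :: "'x::finite pmf" and W :: "'x \<Rightarrow> 'y::finite \<Rightarrow> 'y pmf"
    and X :: "nat \<Rightarrow> 'w \<Rightarrow> 'x" and Y :: "nat \<Rightarrow> 'w \<Rightarrow> 'y"
  assumes process: "input_driven_process M P W X Y"

sublocale channel_process \<subseteq> prob_space M
  using process by (simp add: input_driven_process_def)

context channel_process
begin

section \<open>Law of the sampled path\<close>

definition sample_path :: "nat \<Rightarrow> 'w \<Rightarrow> ('x \<times> 'y) list" where
  "sample_path n \<omega> = map (\<lambda>t. (X t \<omega>, Y t \<omega>)) [1..<Suc n]"

lemma length_sample_path: "length (sample_path n \<omega>) = n"
  by (simp add: sample_path_def)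

lemma map_sample_path: "map fst (sample_path n \<omega>) = prefix_seq X n \<omega>" "map snd (sample_path n \<omega>) = prefix_seq Y n \<omega>"
  by (simp_all add: sample_path_def prefix_seq_def)

lemma sample_path_eq_iff: "sample_path n \<omega> = zs \<longleftrightarrow> prefix_seq X n \<omega> = map fst zs \<and> prefix_seq Y n \<omega> = map snd zs"
  using zip_map_fst_snd[of zs] zip_map_fst_snd[of "sample_path n \<omega>"] by (metis map_sample_path)

lemma X_measurable [measurable]: "X (Suc t) \<in> M \<rightarrow>\<^sub>M count_space UNIV"
  using process by (simp add: input_driven_process_def)

lemma Y_measurable [measurable]: "Y t \<in> M \<rightarrow>\<^sub>M count_space UNIV"
  using process by (simp add: input_driven_process_def)

lemma sample_path_event_sets: "{\<omega>\<in>space M. Y 0 \<omega> = i \<and> sample_path n \<omega> = zs} \<in> sets M"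
proof -
  \<comment> \<open>Written as finitely many conditions on coordinates, the event is visibly
    measurable.\<close>
  have "sample_path n \<omega> = zs \<longleftrightarrow>
      length zs = n \<and> (\<forall>t\<in>{..<n}. X (Suc t) \<omega> = fst (zs ! t) \<and> Y (Suc t) \<omega> = snd (zs ! t))" for \<omega>
    by (auto simp: sample_path_def list_eq_iff_nth_eq prod_eq_iff simp del: upt_Suc)
  then show ?thesis by simp
qed

text \<open>Only finitely many paths have length \<open>n\<close>, and their events are disjoint, so
  the product law of single paths can be summed.\<close>

lemma prob_sample_path_event:
  "prob {\<omega>\<in>space M. Y 0 \<omega> = i \<and> sample_path n \<omega> \<in> A} =
     prob {\<omega>\<in>space M. Y 0 \<omega> = i} * (\<Sum>zs | length zs = n \<and> zs \<in> A. path_prob P W i zs)"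
proof -
  let ?S = "{zs. length zs = n \<and> zs \<in> A}"
  let ?E = "\<lambda>zs. {\<omega>\<in>space M. Y 0 \<omega> = i \<and> sample_path n \<omega> = zs}"
  have "{\<omega>\<in>space M. Y 0 \<omega> = i \<and> sample_path n \<omega> \<in> A} = (\<Union>zs\<in>?S. ?E zs)"
    by (auto simp: length_sample_path)
  also have "prob \<dots> = (\<Sum>zs\<in>?S. prob (?E zs))"
    by (rule finite_measure_finite_Union)
       (auto simp: disjoint_family_on_def sample_path_event_sets intro: finite_subset[OF _ finite_lists_length])
  also have "\<dots> = (\<Sum>zs\<in>?S. prob {\<omega>\<in>space M. Y 0 \<omega> = i} * path_prob P W i zs)"
  proof (rule sum.cong)
    fix zs assume "zs \<in> ?S"
    then have "length zs = n" by simp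
    then show "prob (?E zs) = prob {\<omega>\<in>space M. Y 0 \<omega> = i} * path_prob P W i zs"
      using process[unfolded input_driven_process_def, THEN conjunct2, THEN conjunct2, THEN conjunct2,
          rule_format, of "map fst zs" n "map snd zs" i]
      by (simp only: length_map sample_path_eq_iff path_prob_eq_prod)
  qed simp
  finally show ?thesis by (simp add: sum_distrib_left)
qed

lemma path_sum_sample_path:
  "path_sum G (Y 0 \<omega>) (sample_path n \<omega>) = (\<Sum>t<n. G (Y t \<omega>, X (Suc t) \<omega>, Y (Suc t) \<omega>))"
proof -
  \<comment> \<open>Prepending the starting state makes list positions agree with times.\<close>
  have Y: "(Y 0 \<omega> # map snd (sample_path n \<omega>)) ! t = Y t \<omega>" if "t \<le> n" for t
    using that by (cases t) (auto simp: sample_path_def simp del: upt_Suc)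
  have "(Y 0 \<omega> # map snd (sample_path n \<omega>)) ! (Suc t - 1) = Y t \<omega>"
    "(Y 0 \<omega> # map snd (sample_path n \<omega>)) ! Suc t = Y (Suc t) \<omega>" if "t < n" for t
    using that Y[of t] Y[of "Suc t"] by auto
  moreover have "map fst (sample_path n \<omega>) ! (Suc t - 1) = X (Suc t) \<omega>" if "t < n" for t
    using that by (auto simp: sample_path_def simp del: upt_Suc)
  ultimately show ?thesis
    unfolding path_sum_eq_sum length_sample_path One_nat_def sum.atLeast1_atMost_eq
    by (intro sum.cong) (simp_all only: lessThan_iff)
qed

section \<open>Almost sure averages of centred path sums\<close>

lemma path_sum_measurable [measurable]:
  "(\<lambda>\<omega>. path_sum G (Y 0 \<omega>) (sample_path n \<omega>)) \<in> borel_measurable M"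
proof -
  have [measurable]: "G \<in> count_space UNIV \<rightarrow>\<^sub>M borel" by simp
  show ?thesis unfolding path_sum_sample_path by measurable
qed

lemma AE_eventually_path_sum_less:
  assumes centered: "\<And>i. channel_mean P W G i = 0" and "0 < \<epsilon>"
  shows "AE \<omega> in M. eventually (\<lambda>n. path_sum G (Y 0 \<omega>) (sample_path n \<omega>) < real n * \<epsilon>) sequentially"
proof -
  obtain r where r: "0 < r" "r < 1"
    "\<And>n i. (\<Sum>zs | length zs = n \<and> real n * \<epsilon> \<le> path_sum G i zs. path_prob P W i zs) \<le> r ^ n"
    using path_deviation_le[of P W G \<epsilon>] assms by blast
  let ?E = "\<lambda>n. {\<omega>\<in>space M. real n * \<epsilon> \<le> path_sum G (Y 0 \<omega>) (sample_path n \<omega>)}"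
  \<comment> \<open>Fixing the starting state makes the deviation a condition on the path alone. The
    union bound over the finitely many states then covers any law of \<open>Y 0\<close>.\<close>
  let ?D = "\<lambda>n i. {\<omega>\<in>space M. Y 0 \<omega> = i \<and> sample_path n \<omega> \<in> {zs. real n * \<epsilon> \<le> path_sum G i zs}}"
  have "prob (?E n) \<le> real CARD('y) * r ^ n" for n
  proof -
    have "prob (?D n i) \<le> r ^ n" for i
    proof -
      have "prob (?D n i) \<le> 1 * r ^ n"
        unfolding prob_sample_path_event
        by (rule mult_mono) (use r(3)[of i n] in \<open>auto intro!: sum_nonneg path_prob_nonneg\<close>)
      then show ?thesis by simp
    qed
    moreover have "prob (?E n) \<le> (\<Sum>i\<in>UNIV. prob (?D n i))"
    proof -
      have "?D n i \<in> events" for i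
      proof -
        have "?D n i = {\<omega>\<in>space M. Y 0 \<omega> = i \<and> real n * \<epsilon> \<le> path_sum G (Y 0 \<omega>) (sample_path n \<omega>)}" by auto
        also have "\<dots> \<in> events" by measurable
        finally show ?thesis .
      qed
      moreover have "?E n = (\<Union>i\<in>UNIV. ?D n i)" by auto
      ultimately show ?thesis by (simp only:) (intro finite_measure_subadditive_finite, auto)
    qed
    ultimately show ?thesis using sum_bounded_above[of "UNIV :: 'y set" "\<lambda>i. prob (?D n i)" "r ^ n"] by simp
  qed
  moreover have "summable (\<lambda>n. real CARD('y) * r ^ n)"
    using r by (intro summable_mult summable_geometric) simp
  ultimately have "summable (\<lambda>n. prob (?E n))"
    using summable_comparison_test'[of "\<lambda>n. real CARD('y) * r ^ n" 0 "\<lambda>n. prob (?E n)"] by simp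
  \<comment> \<open>The geometric bound makes the deviation probabilities summable, so almost surely
    only finitely many deviations occur.\<close>
  then have "AE \<omega> in M. eventually (\<lambda>n. \<omega> \<in> space M - ?E n) sequentially"
    by (intro borel_cantelli_AE1) (auto simp: emeasure_eq_measure)
  then show ?thesis
    by eventually_elim (auto elim!: eventually_mono simp: not_le)
qed

lemma AE_path_sum_average_tendsto_0:
  assumes centered: "\<And>i. channel_mean P W G i = 0"
  shows "AE \<omega> in M. (\<lambda>n. path_sum G (Y 0 \<omega>) (sample_path n \<omega>) / real n) \<longlonglongrightarrow> 0"
proof -
  have centered': "channel_mean P W (\<lambda>z. - G z) i = 0" for i
    using channel_mean_cmult[of P W "-1" G i] centered[of i] by simp
  \<comment> \<open>Both signs of \<open>G\<close> give a two-sided bound; restricting the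
    tolerances to \<open>1 / Suc k\<close> keeps the union of null sets countable.\<close>
  have "AE \<omega> in M. \<forall>k. eventually (\<lambda>n. path_sum G (Y 0 \<omega>) (sample_path n \<omega>) < real n * (1 / Suc k)) sequentially \<and>
      eventually (\<lambda>n. path_sum (\<lambda>z. - G z) (Y 0 \<omega>) (sample_path n \<omega>) < real n * (1 / Suc k)) sequentially"
    unfolding AE_all_countable
    by (intro allI AE_conjI AE_eventually_path_sum_less centered centered') auto
  then show ?thesis
  proof eventually_elim
    case (elim \<omega>)
    show ?case
    proof (rule tendstoI)
      fix e :: real assume "0 < e"
      then obtain k where k: "1 / real (Suc k) < e"
        using nat_approx_posE by blast
      have "eventually (\<lambda>n. path_sum G (Y 0 \<omega>) (sample_path n \<omega>) < real n * (1 / Suc k)) sequentially"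
        "eventually (\<lambda>n. path_sum (\<lambda>z. - G z) (Y 0 \<omega>) (sample_path n \<omega>) < real n * (1 / Suc k)) sequentially"
        using elim by blast+
      then show "eventually (\<lambda>n. dist (path_sum G (Y 0 \<omega>) (sample_path n \<omega>) / real n) 0 < e) sequentially"
        using eventually_gt_at_top[of 0]
      proof eventually_elim
        case (elim n)
        have "path_sum (\<lambda>z. - G z) (Y 0 \<omega>) (sample_path n \<omega>) = - path_sum G (Y 0 \<omega>) (sample_path n \<omega>)"
          by (simp add: path_sum_sample_path sum_negf)
        then have "\<bar>path_sum G (Y 0 \<omega>) (sample_path n \<omega>)\<bar> < real n * (1 / Suc k)" using elim by linarith
        also have "\<dots> < real n * e" using k elim by (intro mult_strict_left_mono) auto
        finally show ?case using elim by (simp add: divide_less_eq mult.commute)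
      qed
    qed
  qed
qed

section \<open>Convergence of the empirical triple distribution\<close>

lemma stochastic_induced_chain: "stochastic_matrix (induced_chain P W)"
proof
  show "0 \<le> induced_chain P W i j" for i j
    unfolding induced_chain_def by (intro sum_nonneg) simp
  show "(\<Sum>j\<in>UNIV. induced_chain P W i j) = 1" for i
    unfolding induced_chain_def
    by (subst sum.swap) (simp add: sum_distrib_left[symmetric] sum_pmf_UNIV)
qed

lemma empirical_eq_path_sum:
  "empirical n (Y 0 \<omega>) (prefix_seq X n \<omega>) (prefix_seq Y n \<omega>) z =
     path_sum (\<lambda>w. of_bool (w = z)) (Y 0 \<omega>) (sample_path n \<omega>) / real n"
  unfolding path_sum_eq_sum map_sample_path length_sample_path
  by (cases z) (simp add: empirical_def)

lemma AE_empirical_tendsto: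
  assumes uniq: "\<exists>!C. recurrent_class (induced_chain P W) C"
    and equilibrium: "equilibrium P W \<pi>"
  shows "AE \<omega> in M. (\<lambda>n. empirical n (Y 0 \<omega>) (prefix_seq X n \<omega>) (prefix_seq Y n \<omega>) z)
           \<longlonglongrightarrow> triple_dist \<pi> P W z"
proof -
  define q where "q = triple_dist \<pi> P W z"
  define F where "F w = (of_bool (w = z) :: real)" for w
  \<comment> \<open>\<open>h i\<close> is the probability that the next triple is \<open>z\<close>
    when the previous state is \<open>i\<close>; its mean under \<open>\<pi>\<close> is
    \<open>q\<close>.\<close>
  define h where "h = channel_mean P W F"
  have stationary: "(\<Sum>i\<in>UNIV. pmf \<pi> i * induced_chain P W i j) = pmf \<pi> j" for j
  proof -
    have "(\<Sum>i\<in>UNIV. pmf \<pi> i * induced_chain P W i j) =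
        (\<Sum>x\<in>UNIV. \<Sum>i\<in>UNIV. pmf \<pi> i * pmf P x * pmf (W x i) j)"
      unfolding induced_chain_def sum_distrib_left by (subst sum.swap) (simp add: mult.assoc)
    then show ?thesis using equilibrium unfolding equilibrium_def by metis
  qed
  have "(\<Sum>i\<in>UNIV. pmf \<pi> i * h i) = q"
  proof -
    have "(\<Sum>i\<in>UNIV. pmf \<pi> i * h i) = (\<Sum>w\<in>UNIV. triple_dist \<pi> P W w * F w)"
      unfolding h_def channel_mean_def sum_distrib_left
      by (simp add: sum.cartesian_product case_prod_unfold triple_dist_def mult.assoc)
    also have "\<dots> = q" by (simp add: F_def q_def)
    finally show ?thesis .
  qed
  then have mean: "(\<Sum>i\<in>UNIV. pmf \<pi> i * (h i - q)) = 0"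
    by (simp add: right_diff_distrib sum_subtractf sum_distrib_right[symmetric] sum_pmf_UNIV)
  obtain g where g: "\<And>i. h i - q = g i - (\<Sum>j\<in>UNIV. induced_chain P W i j * g j)"
    by (rule stochastic_matrix.poisson_equation[OF stochastic_induced_chain uniq sum_pmf_UNIV stationary mean]) blast
  \<comment> \<open>The increment \<open>g j - g i\<close> telescopes along a path, and by the
    Poisson equation it cancels the channel mean \<open>h i - q\<close> of
    \<open>F - q\<close>.\<close>
  define G where "G = (\<lambda>(i, x :: 'x, j). F (i, x, j) - q - g i + g j)"
  have "channel_mean P W G i = 0" for i
  proof -
    have "channel_mean P W (\<lambda>(i, x, j). g j) i = (\<Sum>j\<in>UNIV. induced_chain P W i j * g j)"
      unfolding channel_mean_def induced_chain_def sum_distrib_right by (subst sum.swap) simp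
    moreover have "channel_mean P W G i =
        channel_mean P W (\<lambda>w. (F w + (- q - g i)) + (\<lambda>(i, x, j). g j) w) i"
      by (simp add: channel_mean_def G_def algebra_simps)
    ultimately show ?thesis
      using g[of i] by (simp add: channel_mean_add channel_mean_const h_def)
  qed
  then have "AE \<omega> in M. (\<lambda>n. path_sum G (Y 0 \<omega>) (sample_path n \<omega>) / real n) \<longlonglongrightarrow> 0"
    by (rule AE_path_sum_average_tendsto_0)
  then show ?thesis
  proof eventually_elim
    case (elim \<omega>)
    \<comment> \<open>\<open>g\<close> is bounded on the finite state space, so the telescoped
      boundary term vanishes after division by \<open>n\<close>.\<close>
    define C where "C = Max (range (\<lambda>i. \<bar>g i\<bar>))"
    have C: "\<bar>g i\<bar> \<le> C" for i by (simp add: C_def)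
    have "(\<lambda>n. (g (Y 0 \<omega>) - g (Y n \<omega>)) / real n) \<longlonglongrightarrow> 0"
    proof (rule Lim_null_comparison)
      show "eventually (\<lambda>n. norm ((g (Y 0 \<omega>) - g (Y n \<omega>)) / real n) \<le> (2 * C) / real n) sequentially"
      proof (rule always_eventually, rule allI)
        fix n
        have "\<bar>g (Y 0 \<omega>) - g (Y n \<omega>)\<bar> \<le> 2 * C" using C[of "Y 0 \<omega>"] C[of "Y n \<omega>"] by linarith
        then show "norm ((g (Y 0 \<omega>) - g (Y n \<omega>)) / real n) \<le> (2 * C) / real n"
          by (simp add: divide_right_mono)
      qed
      show "(\<lambda>n. (2 * C) / real n) \<longlonglongrightarrow> 0" by (rule lim_const_over_n)
    qed
    then have "(\<lambda>n. path_sum G (Y 0 \<omega>) (sample_path n \<omega>) / real n +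
        (g (Y 0 \<omega>) - g (Y n \<omega>)) / real n + q) \<longlonglongrightarrow> 0 + 0 + q"
      using elim by (intro tendsto_intros)
    then have "(\<lambda>n. path_sum G (Y 0 \<omega>) (sample_path n \<omega>) / real n +
        (g (Y 0 \<omega>) - g (Y n \<omega>)) / real n + q) \<longlonglongrightarrow> q" by simp
    \<comment> \<open>The identity can fail at \<open>n = 0\<close>, where division by zero yields
      0: the left side is \<open>q\<close> and the empirical value is 0.\<close>
    moreover have "eventually (\<lambda>n. path_sum G (Y 0 \<omega>) (sample_path n \<omega>) / real n +
        (g (Y 0 \<omega>) - g (Y n \<omega>)) / real n + q =
        empirical n (Y 0 \<omega>) (prefix_seq X n \<omega>) (prefix_seq Y n \<omega>) z) sequentially"
      using eventually_gt_at_top[of 0]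
    proof eventually_elim
      case (elim n)
      have "path_sum G (Y 0 \<omega>) (sample_path n \<omega>) =
          (\<Sum>t<n. F (Y t \<omega>, X (Suc t) \<omega>, Y (Suc t) \<omega>)) - real n * q + (\<Sum>t<n. g (Y (Suc t) \<omega>) - g (Y t \<omega>))"
        by (simp add: path_sum_sample_path G_def sum.distrib sum_subtractf)
      also have "(\<Sum>t<n. g (Y (Suc t) \<omega>) - g (Y t \<omega>)) = g (Y n \<omega>) - g (Y 0 \<omega>)"
        by (rule sum_lessThan_telescope)
      finally have *: "path_sum G (Y 0 \<omega>) (sample_path n \<omega>) + (g (Y 0 \<omega>) - g (Y n \<omega>)) + real n * q =
          (\<Sum>t<n. F (Y t \<omega>, X (Suc t) \<omega>, Y (Suc t) \<omega>))" by simp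
      have "path_sum G (Y 0 \<omega>) (sample_path n \<omega>) / real n + (g (Y 0 \<omega>) - g (Y n \<omega>)) / real n + q =
          (path_sum G (Y 0 \<omega>) (sample_path n \<omega>) + (g (Y 0 \<omega>) - g (Y n \<omega>)) + real n * q) / real n"
        using elim by (simp add: add_divide_distrib)
      then show ?case
        unfolding * by (simp only: empirical_eq_path_sum path_sum_sample_path F_def)
    qed
    ultimately show ?case unfolding q_def by (rule Lim_transform_eventually)
  qed
qed

text \<open>There are finitely many triples, so one null set serves all of them and the
  coordinatewise limits can be summed.\<close>

lemma AE_l1_dist_empirical_tendsto_0:
  assumes "\<exists>!C. recurrent_class (induced_chain P W) C" "equilibrium P W \<pi>"
  shows "AE \<omega> in M. (\<lambda>n. l1_dist (empirical n (Y 0 \<omega>) (prefix_seq X n \<omega>) (prefix_seq Y n \<omega>))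
           (triple_dist \<pi> P W)) \<longlonglongrightarrow> 0"
proof -
  have "AE \<omega> in M. \<forall>z. (\<lambda>n. empirical n (Y 0 \<omega>) (prefix_seq X n \<omega>) (prefix_seq Y n \<omega>) z)
      \<longlonglongrightarrow> triple_dist \<pi> P W z"
    unfolding AE_all_countable by (intro allI AE_empirical_tendsto[OF assms])
  then show ?thesis
  proof eventually_elim
    case (elim \<omega>)
    have "(\<lambda>n. l1_dist (empirical n (Y 0 \<omega>) (prefix_seq X n \<omega>) (prefix_seq Y n \<omega>)) (triple_dist \<pi> P W))
        \<longlonglongrightarrow> (\<Sum>z\<in>UNIV. \<bar>triple_dist \<pi> P W z - triple_dist \<pi> P W z\<bar>)"
      unfolding l1_dist_def by (intro tendsto_intros elim[rule_format])
    then show ?case by simp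
  qed
qed

text \<open>The indicators of the events tend to 1 almost surely and are bounded by 1, so dominated
  convergence applies.\<close>

lemma prob_tendsto_1_if_AE_eventually:
  assumes [measurable]: "\<And>n. Measurable.pred M (Q n)"
    and "AE \<omega> in M. eventually (\<lambda>n. Q n \<omega>) sequentially"
  shows "(\<lambda>n. prob {\<omega>\<in>space M. Q n \<omega>}) \<longlonglongrightarrow> 1"
proof -
  let ?I = "\<lambda>n. indicator {\<omega>\<in>space M. Q n \<omega>} :: 'w \<Rightarrow> real"
  have "(\<lambda>n. integral\<^sup>L M (?I n)) \<longlonglongrightarrow> integral\<^sup>L M (\<lambda>_. 1)"
  proof (rule integral_dominated_convergence[where w = "\<lambda>_. 1"])
    show "AE \<omega> in M. (\<lambda>n. ?I n \<omega>) \<longlonglongrightarrow> 1"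
      using assms(2) AE_space
    proof eventually_elim
      case (elim \<omega>)
      from elim(1) have "eventually (\<lambda>n. ?I n \<omega> = 1) sequentially"
        by eventually_elim (use elim(2) in simp)
      then show ?case by (rule tendsto_eventually)
    qed
  qed auto
  then show ?thesis by (simp add: prob_space)
qed

lemma l1_dist_empirical_measurable [measurable]:
  "(\<lambda>\<omega>. l1_dist (empirical n (Y 0 \<omega>) (prefix_seq X n \<omega>) (prefix_seq Y n \<omega>)) Q) \<in> borel_measurable M"
  unfolding l1_dist_def empirical_eq_path_sum by measurable

end

theorem theorem2:
  fixes W :: "'x::finite \<Rightarrow> 'y::finite \<Rightarrow> 'y pmf"
    and P :: "'x pmf"
    and \<pi> :: "'y pmf"
    and M :: "'w measure"
    and X :: "nat \<Rightarrow> 'w \<Rightarrow> 'x"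
    and Y :: "nat \<Rightarrow> 'w \<Rightarrow> 'y"
  assumes ergodic: "\<And>P' :: 'x pmf. unique_ergodic_class (induced_chain P' W)"
    and equilibrium: "equilibrium P W \<pi>"
    and process: "input_driven_process M P W X Y"
  shows "(\<forall>\<epsilon>>0. (\<lambda>n. measure M {\<omega> \<in> space M.
              (prefix_seq X n \<omega>, prefix_seq Y n \<omega>) \<in> typical_set n \<epsilon> (Y 0 \<omega>) (triple_dist \<pi> P W)})
            \<longlonglongrightarrow> 1) \<and>
         (AE \<omega> in M. (\<lambda>n. l1_dist (empirical n (Y 0 \<omega>) (prefix_seq X n \<omega>) (prefix_seq Y n \<omega>))
              (triple_dist \<pi> P W)) \<longlonglongrightarrow> 0)"
proof (intro conjI allI impI)
  interpret channel_process M P W X Y by unfold_locales (rule process)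
  let ?d = "\<lambda>n \<omega>. l1_dist (empirical n (Y 0 \<omega>) (prefix_seq X n \<omega>) (prefix_seq Y n \<omega>)) (triple_dist \<pi> P W)"
  have "\<exists>!C. recurrent_class (induced_chain P W) C"
    using ergodic[of P] by (simp add: unique_ergodic_class_def)
  then show AE: "AE \<omega> in M. (\<lambda>n. ?d n \<omega>) \<longlonglongrightarrow> 0"
    using equilibrium by (rule AE_l1_dist_empirical_tendsto_0)
  fix \<epsilon> :: real assume "0 < \<epsilon>"
  have "(\<lambda>n. prob {\<omega>\<in>space M. ?d n \<omega> \<le> \<epsilon>}) \<longlonglongrightarrow> 1"
  proof (rule prob_tendsto_1_if_AE_eventually)
    show "AE \<omega> in M. eventually (\<lambda>n. ?d n \<omega> \<le> \<epsilon>) sequentially"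
      using AE
    proof eventually_elim
      case (elim \<omega>)
      then have "eventually (\<lambda>n. ?d n \<omega> < \<epsilon>) sequentially"
        using \<open>0 < \<epsilon>\<close> by (rule order_tendstoD(2))
      then show ?case by eventually_elim simp
    qed
  qed measurable
  then show "(\<lambda>n. prob {\<omega> \<in> space M.
      (prefix_seq X n \<omega>, prefix_seq Y n \<omega>) \<in> typical_set n \<epsilon> (Y 0 \<omega>) (triple_dist \<pi> P W)}) \<longlonglongrightarrow> 1"
    \<comment> \<open>Both prefixes have length \<open>n\<close>, so membership in the typical set
      reduces to the distance bound.\<close>
    by (simp add: typical_set_def prefix_seq_def del: upt_Suc)
qed

end
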